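(* Let $G=(V,E)$ be a connected amply regular graph with parameters $(n,d,\alpha,\beta)$ (with $n=\infty$ allowed), neither complete nor empty, and consider the signed graph $(G,-)$ where $-$ is the all-$-1$ signature. Let $x\in V$ and let $A_{S_1(x)}$ be the adjacency matrix of the subgraph of $G$ induced by the set $S_1(x)$ of neighbors of $x$. Then $$K_{BE}(-,x)=2+\left(\frac{2d(\beta-2)-\alpha^2}{2\beta}+\frac52\alpha-2\beta+\frac{2}{\beta}\min_{\lambda\in\mathrm{sp}(A_{S_1(x)})}\left(\lambda+\beta-\frac{\alpha}{2}\right)^2\right)_-,$$ where the minimum is taken over all eigenvalues $\lambda$ of $A_{S_1(x)}$ and $a_-:=\min\{0,a\}$ for $a\in\mathbb{R}$.
   Context: All graphs are simple and undirected. An amply regular graph with parameters $(n,d,\alpha,\beta)$ is a $d$-regular graph ($d$ finite) with $n$ vertices, $n=\infty$ being allowed, such that any two adjacent vertices have exactly $\alpha$ common neighbors and any two vertices at distance $2$ have exactly $\beta$ common neighbors. Bakry--Émery curvature of a signed graph: a signed graph $(G,\sigma)$ is a graph $G=(V,E)$ with $\sigma:E\to\{+1,-1\}$; write $\sigma_{xy}=\sigma(xy)$. For $f:V\to\mathbb{R}$ let $\Delta^\sigma f(x)=\sum_{y:\,xy\in E}(\sigma_{xy}f(y)-f(x))$, and let $\Delta$ denote this operator for the all-$+1$ signature. For $f,g:V\to\mathbb{R}$ define $2\Gamma^\sigma(f,g)=\Delta(fg)-(\Delta^\sigma f)g-f(\Delta^\sigma g)$ and $2\Gamma_2^\sigma(f,g)=\Delta\Gamma^\sigma(f,g)-\Gamma^\sigma(\Delta^\sigma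 f,g)-\Gamma^\sigma(f,\Delta^\sigma g)$, and write $\Gamma^\sigma(f)=\Gamma^\sigma(f,f)$, $\Gamma_2^\sigma(f)=\Gamma_2^\sigma(f,f)$. For the all-$-1$ signature $\sigma\equiv-1$, $K_{BE}(-,x)$ is the supremum of all $K\in\mathbb{R}$ such that $\Gamma_2^\sigma(f)(x)\ge K\,\Gamma^\sigma(f)(x)$ for all $f:V\to\mathbb{R}$. *)

theory Defs
  imports "HOL-Library.Extended_Real" "Jordan_Normal_Form.Spectral_Radius"
begin

text \<open>
  Graphs are given by a vertex set and the set of ordered pairs of adjacent vertices.
\<close>

definition simple_graph :: "'a set \<Rightarrow> 'a rel \<Rightarrow> bool" where
  "simple_graph V E \<longleftrightarrow> E \<subseteq> V \<times> V \<and> sym E \<and> irrefl E"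

definition connected_graph :: "'a set \<Rightarrow> 'a rel \<Rightarrow> bool" where
  "connected_graph V E \<longleftrightarrow> (\<forall>x\<in>V. \<forall>y\<in>V. (x, y) \<in> E\<^sup>*)"

definition complete_graph :: "'a set \<Rightarrow> 'a rel \<Rightarrow> bool" where
  "complete_graph V E \<longleftrightarrow> (\<forall>x\<in>V. \<forall>y\<in>V. x \<noteq> y \<longrightarrow> (x, y) \<in> E)"

definition empty_graph :: "'a rel \<Rightarrow> bool" where
  "empty_graph E \<longleftrightarrow> E = {}"

definition nbrs :: "'a rel \<Rightarrow> 'a \<Rightarrow> 'a set" where
  "nbrs E x = {y. (x, y) \<in> E}"

text \<open>Length of a shortest walk; \<open>\<infinity>\<close> if there is none.\<close>

definition graph_dist :: "'a rel \<Rightarrow> 'a \<Rightarrow> 'a \<Rightarrow> enat" where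
  "graph_dist E x y = Inf {enat k |k. (x, y) \<in> E ^^ k}"

definition num_vertices :: "'a set \<Rightarrow> enat" where
  "num_vertices V = (if finite V then enat (card V) else \<infinity>)"

definition amply_regular ::
  "'a set \<Rightarrow> 'a rel \<Rightarrow> enat \<Rightarrow> nat \<Rightarrow> nat \<Rightarrow> nat \<Rightarrow> bool" where
  "amply_regular V E n d \<alpha> \<beta> \<longleftrightarrow>
     simple_graph V E \<and>
     num_vertices V = n \<and>
     (\<forall>x\<in>V. finite (nbrs E x) \<and> card (nbrs E x) = d) \<and>
     (\<forall>x\<in>V. \<forall>y\<in>V. (x, y) \<in> E \<longrightarrow> card (nbrs E x \<inter> nbrs E y) = \<alpha>) \<and>
     (\<forall>x\<in>V. \<forall>y\<in>V. graph_dist E x y = 2 \<longrightarrow> card (nbrs E x \<inter> nbrs E y) = \<beta>)"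

text \<open>
  A signature assigns \<open>1\<close> or \<open>-1\<close> to each edge, an edge being the unordered pair
  \<open>{x, y}\<close>. Its values on other sets play no role, and neither do the values of
  \<open>f :: 'a \<Rightarrow> real\<close> outside the vertex set, when the operators below are evaluated at
  a vertex.
\<close>

definition signed_laplacian ::
  "'a rel \<Rightarrow> ('a set \<Rightarrow> real) \<Rightarrow> ('a \<Rightarrow> real) \<Rightarrow> 'a \<Rightarrow> real" where
  "signed_laplacian E \<sigma> f x = (\<Sum>y\<in>nbrs E x. \<sigma> {x, y} * f y - f x)"

abbreviation all_plus :: "'a set \<Rightarrow> real" where
  "all_plus \<equiv> \<lambda>_. 1"

abbreviation all_minus :: "'a set \<Rightarrow> real" where
  "all_minus \<equiv> \<lambda>_. -1"

definition Gamma_op ::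
  "'a rel \<Rightarrow> ('a set \<Rightarrow> real) \<Rightarrow> ('a \<Rightarrow> real) \<Rightarrow> ('a \<Rightarrow> real) \<Rightarrow> 'a \<Rightarrow> real" where
  "Gamma_op E \<sigma> f g x =
     (signed_laplacian E all_plus (\<lambda>z. f z * g z) x
      - signed_laplacian E \<sigma> f x * g x
      - f x * signed_laplacian E \<sigma> g x) / 2"

definition Gamma2_op ::
  "'a rel \<Rightarrow> ('a set \<Rightarrow> real) \<Rightarrow> ('a \<Rightarrow> real) \<Rightarrow> ('a \<Rightarrow> real) \<Rightarrow> 'a \<Rightarrow> real" where
  "Gamma2_op E \<sigma> f g x =
     (signed_laplacian E all_plus (Gamma_op E \<sigma> f g) x
      - Gamma_op E \<sigma> (signed_laplacian E \<sigma> f) g x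
      - Gamma_op E \<sigma> f (signed_laplacian E \<sigma> g) x) / 2"

text \<open>
  The supremum is taken in the extended reals, so that an empty or unbounded set of
  admissible \<open>K\<close> does not yield an unspecified real number.
\<close>

definition K_BE :: "'a rel \<Rightarrow> ('a set \<Rightarrow> real) \<Rightarrow> 'a \<Rightarrow> ereal" where
  "K_BE E \<sigma> x =
     Sup {ereal K |K. \<forall>f. Gamma2_op E \<sigma> f f x \<ge> K * Gamma_op E \<sigma> f f x}"

text \<open>
  Adjacency matrix of the subgraph induced on \<open>set vs\<close>, with rows and columns ordered
  as in the distinct list \<open>vs\<close>. It is real symmetric, so its real spectrum contains
  all of its eigenvalues.
\<close>

definition induced_adj_mat :: "'a rel \<Rightarrow> 'a list \<Rightarrow> real mat" where
  "induced_adj_mat E vs =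
     mat (length vs) (length vs) (\<lambda>(i, j). if (vs ! i, vs ! j) \<in> E then 1 else 0)"

end

theory Submission
  imports Defs "HOL-Analysis.Function_Topology"
begin

text \<open>
  Fix \<open>f\<close> and put \<open>u = f + f x\<close> on the set \<open>N\<close> of neighbours of \<open>x\<close>. Then \<open>2 \<Gamma>(f)(x) = |u|\<^sup>2\<close>.
  In \<open>4 \<Gamma>\<^sub>2(f)(x)\<close> the number \<open>f x\<close> and the values of \<open>f\<close> on the second sphere enter as free
  variables; completing squares minimises over them. Amply regularity expresses the
  number of paths of length two through the second sphere by the adjacency matrix \<open>A\<close> of
  \<open>N\<close>, so the minimum is a quadratic form in \<open>u\<close> built from \<open>A\<close> and the all-ones matrix. As \<open>N\<close>
  induces an \<open>\<alpha>\<close>-regular graph, this form splits along constants, where its quotient by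
  \<open>2 |u|\<^sup>2\<close> is 2, and their orthogonal complement, where the quotient is the other
  expression of the theorem evaluated at the eigenvalues of \<open>A\<close>. The eigenvalue \<open>\<alpha>\<close> may
  belong to constants alone, but then its contribution is at least 2.
\<close>

subsection \<open>Symmetric real kernels on finite sets\<close>

text \<open>First-order condition at a minimum. If p were nonzero, the step -p / r with r >
  \<bar>q\<bar> would be short enough for the linear term to beat the quadratic one.\<close>

lemma linear_coeff_zero_if_quadratic_nonneg:
  fixes p q :: real
  assumes nonneg: "\<And>t. 0 \<le> 2 * t * p + t\<^sup>2 * q"
  shows "p = 0"
proof (rule ccontr)
  assume "p \<noteq> 0"
  define r where "r = \<bar>q\<bar> + 1"
  have r: "r > 0" "q < r" by (auto simp: r_def)
  have "0 \<le> 2 * (- p / r) * p + (- p / r)\<^sup>2 * q" by (rule nonneg)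
  also have "\<dots> = p\<^sup>2 / r\<^sup>2 * (q - 2 * r)"
    using r by (simp add: field_simps power2_eq_square)
  also have "\<dots> < 0"
    using r \<open>p \<noteq> 0\<close> by (intro mult_pos_neg) auto
  finally show False by simp
qed

lemma continuous_on_coordinate [continuous_intros]:
  "continuous_on A (\<lambda>u :: 'a \<Rightarrow> real. u y)"
  by (rule continuous_on_subset[OF continuous_on_product_coordinates]) simp

lemma quadratic_form_minimiser:
  fixes B :: "'a \<Rightarrow> 'a \<Rightarrow> real"
  assumes S: "finite S" "S \<noteq> {}"
  obtains u m where "(\<Sum>y\<in>S. (u y)\<^sup>2) = 1"
    and "(\<Sum>y\<in>S. (\<Sum>z\<in>S. B y z * u z)\<^sup>2) = m"
    and "\<And>v. m * (\<Sum>y\<in>S. (v y)\<^sup>2) \<le> (\<Sum>y\<in>S. (\<Sum>z\<in>S. B y z * v z)\<^sup>2)"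
proof -
  define Q where "Q u = (\<Sum>y\<in>S. (\<Sum>z\<in>S. B y z * u z)\<^sup>2)" for u
  define n2 where "n2 u = (\<Sum>y\<in>S. (u y)\<^sup>2)" for u :: "'a \<Rightarrow> real"
  \<comment> \<open>The function type may have infinitely many coordinates. Pinning those outside
    \<open>S\<close> to 0 makes the unit sphere a closed subset of a product of compact sets, so
    Tychonoff's theorem applies.\<close>
  define I where "I y = (if y \<in> S then {-1..1} else {0::real})" for y
  define K where "K = PiE UNIV I \<inter> {u. n2 u = 1}"
  have "compactin (product_topology (\<lambda>_. euclidean) UNIV) (PiE UNIV I)"
    unfolding compactin_PiE by (auto simp: I_def)
  then have "compact (PiE UNIV I)"
    by (simp add: euclidean_product_topology)
  moreover have "closed {u. n2 u = 1}"
    unfolding n2_def by (intro closed_Collect_eq continuous_intros)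
  ultimately have "compact K"
    unfolding K_def by (rule compact_Int_closed)
  moreover have "K \<noteq> {}"
  proof -
    obtain y where y: "y \<in> S" using S by auto
    have "(\<lambda>z. if z = y then 1 else 0) \<in> K"
      using y S(1) by (auto simp: K_def I_def n2_def if_distrib[where f = "\<lambda>t. t\<^sup>2"] cong: if_cong)
    then show ?thesis by auto
  qed
  moreover have "continuous_on K Q"
    unfolding Q_def by (intro continuous_intros)
  ultimately obtain u where u: "u \<in> K" "\<And>v. v \<in> K \<Longrightarrow> Q u \<le> Q v"
    using continuous_attains_inf by metis
  have min: "Q u * n2 v \<le> Q v" for v
  proof (cases "n2 v = 0")
    case True
    then show ?thesis by (simp add: Q_def sum_nonneg)
  next
    case False
    then have pos: "n2 v > 0" by (simp add: n2_def sum_nonneg order_less_le)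
    \<comment> \<open>\<open>v\<close> is cut off outside \<open>S\<close> and normalised, so that
      it lies in \<open>K\<close>; \<open>Q\<close> and \<open>n2\<close> read only the values on
      \<open>S\<close>.\<close>
    define w where "w z = (if z \<in> S then v z / sqrt (n2 v) else 0)" for z
    have wQ: "Q w = Q v / n2 v"
    proof -
      have "(\<Sum>z\<in>S. B y z * w z) = (\<Sum>z\<in>S. B y z * v z) / sqrt (n2 v)" for y
        by (simp add: w_def sum_divide_distrib)
      then show ?thesis
        using pos by (simp add: Q_def power_divide flip: sum_divide_distrib)
    qed
    have wn: "n2 w = 1"
    proof -
      have "n2 w = n2 v / n2 v"
        unfolding n2_def sum_divide_distrib
        using pos by (intro sum.cong) (simp_all add: w_def power_divide n2_def)
      then show ?thesis using pos by simp
    qed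
    have "w z \<in> I z" for z
    proof (cases "z \<in> S")
      case True
      then have "(w z)\<^sup>2 \<le> 1"
        unfolding wn[symmetric] n2_def using S(1) by (intro member_le_sum) auto
      then show ?thesis using True by (auto simp: I_def abs_square_le_1 abs_le_iff)
    qed (auto simp: I_def w_def)
    then have "w \<in> K" using wn by (auto simp: K_def)
    from u(2)[OF this] show ?thesis using pos by (simp add: wQ field_simps)
  qed
  show ?thesis
    by (rule that[of u "Q u"]) (use u(1) min in \<open>auto simp: K_def Q_def n2_def\<close>)
qed

text \<open>
  A minimiser of \<open>|B u|\<^sup>2\<close> on the unit sphere solves \<open>B\<^sup>2 u = m u\<close>. With \<open>r = sqrt m\<close>, either
  \<open>(B + r) u = 0\<close>, or \<open>(B + r) u\<close> is an eigenvector of \<open>B\<close> for \<open>r\<close>.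
\<close>
lemma symmetric_min_eigenpair:
  fixes B :: "'a \<Rightarrow> 'a \<Rightarrow> real"
  assumes S: "finite S" "S \<noteq> {}" and sym: "\<And>y z. B y z = B z y"
  obtains \<mu> v where "\<exists>y\<in>S. v y \<noteq> 0"
    and "\<And>y. y \<in> S \<Longrightarrow> (\<Sum>z\<in>S. B y z * v z) = \<mu> * v y"
    and "\<And>u. \<mu>\<^sup>2 * (\<Sum>y\<in>S. (u y)\<^sup>2) \<le> (\<Sum>y\<in>S. (\<Sum>z\<in>S. B y z * u z)\<^sup>2)"
proof -
  define b where "b u y = (\<Sum>z\<in>S. B y z * u z)" for u y
  obtain u m where u: "(\<Sum>y\<in>S. (u y)\<^sup>2) = 1" "(\<Sum>y\<in>S. (b u y)\<^sup>2) = m"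
    and min: "\<And>v. m * (\<Sum>y\<in>S. (v y)\<^sup>2) \<le> (\<Sum>y\<in>S. (b v y)\<^sup>2)"
    using quadratic_form_minimiser[OF S, of B, folded b_def] by blast
  have lin: "b (\<lambda>z. s z + t * w z) y = b s y + t * b w y" for s t w y
    by (simp add: b_def algebra_simps sum.distrib sum_distrib_left)
  have adj: "(\<Sum>y\<in>S. b s y * t y) = (\<Sum>y\<in>S. s y * b t y)" for s t
  proof -
    have "(\<Sum>y\<in>S. b s y * t y) = (\<Sum>y\<in>S. \<Sum>z\<in>S. B y z * s z * t y)"
      by (simp add: b_def sum_distrib_right)
    also have "\<dots> = (\<Sum>z\<in>S. \<Sum>y\<in>S. B y z * s z * t y)" by (rule sum.swap)
    also have "\<dots> = (\<Sum>y\<in>S. s y * b t y)"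
      by (simp add: b_def sum_distrib_left sym mult_ac)
    finally show ?thesis .
  qed
  \<comment> \<open>The residual of the desired equation serves as its own test direction:
    minimality along u + t w makes <b u, b w> - m <u, w> vanish, and by self-adjointness of
    \<open>b\<close> this number is |w|^2.\<close>
  define w where "w y = b (b u) y - m * u y" for y
  have "(\<Sum>y\<in>S. b u y * b w y) - m * (\<Sum>y\<in>S. u y * w y) = 0"
  proof (rule linear_coeff_zero_if_quadratic_nonneg)
    fix t
    have "(\<Sum>y\<in>S. (u y + t * w y)\<^sup>2) =
        (\<Sum>y\<in>S. (u y)\<^sup>2) + 2 * t * (\<Sum>y\<in>S. u y * w y) + t\<^sup>2 * (\<Sum>y\<in>S. (w y)\<^sup>2)"
      by (simp add: power2_sum power_mult_distrib sum.distrib sum_distrib_left mult_ac)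
    moreover have "(\<Sum>y\<in>S. (b u y + t * b w y)\<^sup>2) =
        (\<Sum>y\<in>S. (b u y)\<^sup>2) + 2 * t * (\<Sum>y\<in>S. b u y * b w y) + t\<^sup>2 * (\<Sum>y\<in>S. (b w y)\<^sup>2)"
      by (simp add: power2_sum power_mult_distrib sum.distrib sum_distrib_left mult_ac)
    ultimately show "0 \<le> 2 * t * ((\<Sum>y\<in>S. b u y * b w y) - m * (\<Sum>y\<in>S. u y * w y))
        + t\<^sup>2 * ((\<Sum>y\<in>S. (b w y)\<^sup>2) - m * (\<Sum>y\<in>S. (w y)\<^sup>2))"
      using min[of "\<lambda>y. u y + t * w y"] u by (simp add: lin algebra_simps)
  qed
  moreover have "(\<Sum>y\<in>S. (w y)\<^sup>2) = (\<Sum>y\<in>S. b (b u) y * w y) - m * (\<Sum>y\<in>S. u y * w y)"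
    unfolding sum_distrib_left sum_subtractf[symmetric]
    by (rule sum.cong) (simp_all add: w_def power2_eq_square algebra_simps)
  ultimately have "(\<Sum>y\<in>S. (w y)\<^sup>2) = 0"
    using adj[of "b u" w] by simp
  then have bb: "b (b u) y = m * u y" if "y \<in> S" for y
    using that S(1) by (simp add: sum_nonneg_eq_0_iff w_def)
  define r where "r = sqrt m"
  have "m \<ge> 0" unfolding u(2)[symmetric] by (simp add: sum_nonneg)
  then have r: "r\<^sup>2 = m" by (simp add: r_def)
  show ?thesis
  proof (cases "\<exists>y\<in>S. b u y + r * u y \<noteq> 0")
    case True
    have "b (\<lambda>z. b u z + r * u z) y = r * (b u y + r * u y)" if "y \<in> S" for y
      using bb[OF that] r by (simp add: lin algebra_simps power2_eq_square)
    then show ?thesis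
      by (intro that[of "\<lambda>z. b u z + r * u z" r]) (use True min r in \<open>auto simp: b_def\<close>)
  next
    case False
    have "\<exists>y\<in>S. u y \<noteq> 0" using u(1) by (metis (no_types, lifting) power_zero_numeral sum.neutral zero_neq_one)
    moreover have "b u y = - r * u y" if "y \<in> S" for y
      using False that by (auto simp: add_eq_0_iff)
    ultimately show ?thesis
      by (intro that[of u "- r"]) (use min r in \<open>auto simp: b_def\<close>)
  qed
qed

section \<open>Matrix spectrum in terms of functions on the vertices\<close>

definition adj :: "'a rel \<Rightarrow> 'a \<Rightarrow> 'a \<Rightarrow> real" where
  "adj E y z = of_bool ((y, z) \<in> E)"

lemma mem_spectrum_induced_adj_mat_iff:
  assumes "distinct vs"
  shows "l \<in> spectrum (induced_adj_mat E vs) \<longleftrightarrow>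
    (\<exists>v. (\<exists>y\<in>set vs. v y \<noteq> 0) \<and> (\<forall>y\<in>set vs. (\<Sum>z\<in>set vs. adj E y z * v z) = l * v y))"
proof -
  let ?n = "length vs" and ?A = "induced_adj_mat E vs"
  have A: "?A \<in> carrier_mat ?n ?n" by (simp add: induced_adj_mat_def)
  have bij: "bij_betw ((!) vs) {0..<?n} (set vs)"
    using bij_betw_nth[OF assms refl refl] by (simp add: atLeast0LessThan)
  have mult: "(?A *\<^sub>v vec ?n (\<lambda>i. v (vs ! i))) $ i = (\<Sum>z\<in>set vs. adj E (vs ! i) z * v z)"
    if "i < ?n" for v i
    using that unfolding sum.reindex_bij_betw[OF bij, symmetric]
    by (simp add: induced_adj_mat_def scalar_prod_def adj_def of_bool_def)
  have ev: "eigenvector ?A (vec ?n (\<lambda>i. v (vs ! i))) l \<longleftrightarrow>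
      (\<exists>y\<in>set vs. v y \<noteq> 0) \<and> (\<forall>y\<in>set vs. (\<Sum>z\<in>set vs. adj E y z * v z) = l * v y)" for v
  proof -
    have "vec ?n (\<lambda>i. v (vs ! i)) \<noteq> 0\<^sub>v ?n \<longleftrightarrow> (\<exists>y\<in>set vs. v y \<noteq> 0)"
      by (auto simp: vec_eq_iff set_conv_nth)
    moreover have "?A *\<^sub>v vec ?n (\<lambda>i. v (vs ! i)) = l \<cdot>\<^sub>v vec ?n (\<lambda>i. v (vs ! i)) \<longleftrightarrow>
        (\<forall>i<?n. (\<Sum>z\<in>set vs. adj E (vs ! i) z * v z) = l * v (vs ! i))"
      using A mult[of _ v] by (auto simp: vec_eq_iff simp del: index_mult_mat_vec)
    ultimately show ?thesis
      using A by (auto simp: eigenvector_def all_set_conv_all_nth)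
  qed
  show ?thesis
  proof
    assume "l \<in> spectrum ?A"
    then obtain w where w: "eigenvector ?A w l"
      by (auto simp: spectrum_def eigenvalue_def)
    then have "dim_vec w = ?n" using A by (auto simp: eigenvector_def)
    moreover define v where "v = (\<lambda>y. w $ (the_inv_into {0..<?n} ((!) vs) y))"
    moreover have "the_inv_into {0..<?n} ((!) vs) (vs ! i) = i" if "i < ?n" for i
      using that bij by (simp add: the_inv_into_f_f bij_betw_def)
    ultimately have "w = vec ?n (\<lambda>i. v (vs ! i))" by (intro eq_vecI) auto
    with w ev[of v] show "\<exists>v. (\<exists>y\<in>set vs. v y \<noteq> 0) \<and>
        (\<forall>y\<in>set vs. (\<Sum>z\<in>set vs. adj E y z * v z) = l * v y)" by blast
  qed (use ev in \<open>auto simp: spectrum_def eigenvalue_def\<close>)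
qed

subsection \<open>Curvature at a vertex of an amply regular graph\<close>

lemma Gamma_op_all_minus:
  "Gamma_op E all_minus f g y = (\<Sum>z\<in>nbrs E y. (f y + f z) * (g y + g z)) / 2"
  unfolding Gamma_op_def signed_laplacian_def sum_distrib_left sum_distrib_right sum_subtractf[symmetric]
  by (intro arg_cong[where f = "\<lambda>t. t / 2"] sum.cong) (simp_all add: algebra_simps)

text \<open>With all signs -1 the signed Laplacian is minus the sum of f z + f w over the neighbours
  w of z, so only such edge sums occur. The factor 4 clears both halvings.\<close>

lemma Gamma2_op_all_minus:
  "4 * Gamma2_op E all_minus f f y =
     (\<Sum>z\<in>nbrs E y. (\<Sum>w\<in>nbrs E z. (f z + f w)\<^sup>2) - (\<Sum>w\<in>nbrs E y. (f y + f w)\<^sup>2)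
       + 2 * (f y + f z) * ((\<Sum>w\<in>nbrs E y. f y + f w) + (\<Sum>w\<in>nbrs E z. f z + f w)))"
proof -
  define S where "S z = (\<Sum>w\<in>nbrs E z. f z + f w)" for z
  define G where "G z = (\<Sum>w\<in>nbrs E z. (f z + f w)\<^sup>2)" for z
  have L: "signed_laplacian E all_minus f = (\<lambda>z. - S z)"
    by (simp add: fun_eq_iff signed_laplacian_def S_def sum_subtractf sum.distrib sum_negf)
  have Gamma: "Gamma_op E all_minus f f = (\<lambda>z. G z / 2)"
    by (simp add: fun_eq_iff Gamma_op_all_minus G_def power2_eq_square)
  have "4 * Gamma2_op E all_minus f f y =
      2 * (\<Sum>z\<in>nbrs E y. G z / 2 - G y / 2) - (\<Sum>z\<in>nbrs E y. (- S y - S z) * (f y + f z))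
      - (\<Sum>z\<in>nbrs E y. (f y + f z) * (- S y - S z))"
    unfolding Gamma2_op_def L Gamma by (simp add: Gamma_op_all_minus signed_laplacian_def)
  also have "\<dots> = (\<Sum>z\<in>nbrs E y. G z - G y + 2 * (f y + f z) * (S y + S z))"
    unfolding sum_distrib_left sum_subtractf[symmetric]
    by (intro sum.cong) (simp_all add: algebra_simps)
  finally show ?thesis by (simp add: S_def G_def)
qed

text \<open>Distance two is replaced by being distinct, nonadjacent and having a common neighbour.
  The two inequalities on the parameters encode that the graph is connected and not complete, as far
  as the curvature needs it.\<close>

locale amply_regular_at =
  fixes V :: "'a set" and E :: "'a rel" and d \<alpha> \<beta> :: nat and x :: 'a
  assumes E_subset: "E \<subseteq> V \<times> V" and sym_E: "sym E" and irrefl_E: "irrefl E"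
    and finite_nbrs: "y \<in> V \<Longrightarrow> finite (nbrs E y)"
    and degree: "y \<in> V \<Longrightarrow> card (nbrs E y) = d"
    and common_adjacent: "(y, z) \<in> E \<Longrightarrow> card (nbrs E y \<inter> nbrs E z) = \<alpha>"
    and common_nonadjacent:
      "y \<noteq> z \<Longrightarrow> (y, z) \<notin> E \<Longrightarrow> w \<in> nbrs E y \<Longrightarrow> w \<in> nbrs E z
        \<Longrightarrow> card (nbrs E y \<inter> nbrs E z) = \<beta>"
    and x_in: "x \<in> V" and \<beta>_pos: "0 < \<beta>" and degree_ge: "\<alpha> + 2 \<le> d"
begin

section \<open>Counting edges between the first and the second sphere\<close>

abbreviation N :: "'a set" where "N \<equiv> nbrs E x"

definition S2 :: "'a set" where
  "S2 = {z. z \<noteq> x \<and> z \<notin> N \<and> (\<exists>y\<in>N. (y, z) \<in> E)}"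

definition A :: "('a \<Rightarrow> real) \<Rightarrow> 'a \<Rightarrow> real" where
  "A u y = (\<Sum>z\<in>N. adj E y z * u z)"

lemma edge_commute: "(y, z) \<in> E \<longleftrightarrow> (z, y) \<in> E"
  using sym_E by (auto simp: sym_def)

lemma adj_commute: "adj E y z = adj E z y"
  by (simp add: adj_def edge_commute)

lemma mem_nbrs: "z \<in> nbrs E y \<longleftrightarrow> (y, z) \<in> E"
  by (simp add: nbrs_def)

lemma no_loop: "(y, y) \<notin> E"
  using irrefl_E by (auto simp: irrefl_def)

lemma N_subset: "N \<subseteq> V"
  using E_subset by (auto simp: nbrs_def)

lemma finite_N: "finite N"
  by (rule finite_nbrs[OF x_in])

lemma card_N: "card N = d"
  by (rule degree[OF x_in])

lemma finite_S2: "finite S2"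
proof (rule finite_subset)
  show "S2 \<subseteq> (\<Union>y\<in>N. nbrs E y)" by (auto simp: S2_def nbrs_def)
  show "finite (\<Union>y\<in>N. nbrs E y)" using finite_N N_subset finite_nbrs by blast
qed

lemma card_common:
  assumes "y \<in> V"
  shows "(\<Sum>w\<in>nbrs E y. adj E z w) = real (card (nbrs E y \<inter> nbrs E z))"
  using finite_nbrs[OF assms] by (simp add: adj_def nbrs_def)

text \<open>A neighbour of y is x, another neighbour of x, or on the second sphere. The weights
  \<open>adj\<close> keep the index sets independent of y, so that sums can later be
  exchanged.\<close>

lemma sum_nbrs:
  assumes y: "y \<in> N"
  shows "(\<Sum>z\<in>nbrs E y. \<phi> z) =
    \<phi> x + (\<Sum>z\<in>N. adj E y z * \<phi> z) + (\<Sum>z\<in>S2. adj E y z * (\<phi> z :: real))"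
proof -
  have "nbrs E y = insert x ((N \<inter> nbrs E y) \<union> (S2 \<inter> nbrs E y))"
    using y by (auto simp: S2_def mem_nbrs edge_commute)
  moreover have "x \<notin> (N \<inter> nbrs E y) \<union> (S2 \<inter> nbrs E y)"
    by (auto simp: S2_def mem_nbrs no_loop)
  ultimately have "(\<Sum>z\<in>nbrs E y. \<phi> z) = \<phi> x + (\<Sum>z\<in>(N \<inter> nbrs E y) \<union> (S2 \<inter> nbrs E y). \<phi> z)"
    using finite_N finite_S2 by (metis finite_Int finite_UnI sum.insert)
  also have "(\<Sum>z\<in>(N \<inter> nbrs E y) \<union> (S2 \<inter> nbrs E y). \<phi> z) =
      (\<Sum>z\<in>N \<inter> nbrs E y. \<phi> z) + (\<Sum>z\<in>S2 \<inter> nbrs E y. \<phi> z)"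
    using finite_N finite_S2 by (intro sum.union_disjoint) (auto simp: S2_def)
  finally have "(\<Sum>z\<in>nbrs E y. \<phi> z) =
      \<phi> x + (\<Sum>z\<in>N \<inter> nbrs E y. \<phi> z) + (\<Sum>z\<in>S2 \<inter> nbrs E y. \<phi> z)"
    by (simp only: add.assoc)
  moreover have "(\<Sum>z\<in>T \<inter> nbrs E y. \<phi> z) = (\<Sum>z\<in>T. adj E y z * \<phi> z)" if "finite T" for T
    using that by (simp add: adj_def nbrs_def)
  ultimately show ?thesis using finite_N finite_S2 by simp
qed

lemma sum_adj_N:
  assumes "y \<in> N"
  shows "(\<Sum>z\<in>N. adj E y z) = \<alpha>"
  using assms common_adjacent[of x y] by (simp add: card_common[OF x_in] mem_nbrs)

lemma sum_adj_S2:
  assumes y: "y \<in> N"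
  shows "(\<Sum>z\<in>S2. adj E y z) = real d - 1 - \<alpha>"
  using sum_nbrs[OF y, of "\<lambda>_. 1"] degree[of y] N_subset y by (auto simp: sum_adj_N)

lemma sum_adj_from_S2:
  assumes z: "z \<in> S2"
  shows "(\<Sum>y\<in>N. adj E y z) = \<beta>"
proof -
  obtain y where "z \<noteq> x" "(x, z) \<notin> E" "y \<in> N" "(y, z) \<in> E"
    using z by (auto simp: S2_def mem_nbrs)
  then have "card (N \<inter> nbrs E z) = \<beta>"
    by (intro common_nonadjacent[of x z y]) (auto simp: mem_nbrs edge_commute)
  then show ?thesis
    by (simp add: adj_commute[of _ z] card_common[OF x_in])
qed

text \<open>Distinct y and y' are adjacent or, sharing x, at distance two; so all their common
  neighbours number \<alpha> or \<beta>, and d if y = y'. Removing x and those inside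
  \<open>N\<close> leaves the entry of (d - \<beta>) I + (\<alpha> - \<beta>) A + (\<beta> - 1) J -
  A^2, where J is all ones.\<close>

lemma codegree_S2:
  assumes y: "y \<in> N" and y': "y' \<in> N"
  shows "(\<Sum>z\<in>S2. adj E y z * adj E y' z) =
    of_bool (y = y') * (real d - \<beta>) + (real \<alpha> - \<beta>) * adj E y y' + (real \<beta> - 1)
      - (\<Sum>w\<in>N. adj E y w * adj E y' w)"
proof -
  have "(\<Sum>z\<in>nbrs E y. adj E y' z) =
      of_bool (y = y') * (real d - \<beta>) + (real \<alpha> - \<beta>) * adj E y y' + \<beta>"
  proof -
    have yV: "y \<in> V" using y N_subset by auto
    consider "y = y'" | "(y, y') \<in> E" "y \<noteq> y'" | "(y, y') \<notin> E" "y \<noteq> y'" by blast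
    then show ?thesis
    proof cases
      case 1
      then show ?thesis using card_common[OF yV] degree[OF yV] by (simp add: adj_def no_loop)
    next
      case 2
      then show ?thesis using card_common[OF yV] common_adjacent by (simp add: adj_def)
    next
      case 3
      then have "card (nbrs E y \<inter> nbrs E y') = \<beta>"
        using y y' by (intro common_nonadjacent[of y y' x]) (auto simp: mem_nbrs edge_commute)
      then show ?thesis using card_common[OF yV] 3 by (simp add: adj_def)
    qed
  qed
  moreover have "adj E y' x = 1"
    using y' by (simp add: adj_def mem_nbrs edge_commute)
  ultimately show ?thesis
    using sum_nbrs[OF y, of "adj E y'"] by simp
qed

lemma sum_A: "(\<Sum>y\<in>N. A u y) = real \<alpha> * (\<Sum>y\<in>N. u y)"
proof -
  have "(\<Sum>y\<in>N. A u y) = (\<Sum>z\<in>N. \<Sum>y\<in>N. adj E y z * u z)"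
    unfolding A_def by (rule sum.swap)
  also have "\<dots> = (\<Sum>z\<in>N. (\<Sum>y\<in>N. adj E z y) * u z)"
    by (simp add: sum_distrib_right adj_commute)
  also have "\<dots> = real \<alpha> * (\<Sum>y\<in>N. u y)"
    by (simp add: sum_adj_N sum_distrib_left)
  finally show ?thesis .
qed

lemma A_const:
  fixes c :: real
  assumes "y \<in> N"
  shows "A (\<lambda>_. c) y = \<alpha> * c"
  using sum_adj_N[OF assms] by (simp add: A_def flip: sum_distrib_right)

lemma A_add_scaled: "A (\<lambda>z. u z + c * v z) y = A u y + c * A v y"
  by (simp add: A_def algebra_simps sum.distrib sum_distrib_left)

section \<open>Reduction to a quadratic form on the first sphere\<close>

definition P :: "('a \<Rightarrow> real) \<Rightarrow> 'a \<Rightarrow> real" where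
  "P u z = (\<Sum>y\<in>N. adj E y z * u y)"

lemma sum_P_squared:
  "(\<Sum>z\<in>S2. (P u z)\<^sup>2) = (real d - \<beta>) * (\<Sum>y\<in>N. (u y)\<^sup>2) + (real \<alpha> - \<beta>) * (\<Sum>y\<in>N. u y * A u y)
    + (real \<beta> - 1) * (\<Sum>y\<in>N. u y)\<^sup>2 - (\<Sum>y\<in>N. (A u y)\<^sup>2)"
proof -
  \<comment> \<open>Used twice: \<open>T = S2\<close> brings in the codegrees, and
    \<open>T = N\<close> turns the A^2 term back into the squared norm of
    \<open>A u\<close>.\<close>
  have swap: "(\<Sum>z\<in>T. (\<Sum>y\<in>N. adj E y z * u y)\<^sup>2) =
      (\<Sum>y\<in>N. \<Sum>y'\<in>N. u y * u y' * (\<Sum>z\<in>T. adj E y z * adj E y' z))" for T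
  proof -
    have "(\<Sum>z\<in>T. (\<Sum>y\<in>N. adj E y z * u y)\<^sup>2) =
        (\<Sum>z\<in>T. \<Sum>y\<in>N. \<Sum>y'\<in>N. u y * u y' * (adj E y z * adj E y' z))"
      by (simp add: power2_eq_square sum_product mult_ac)
    also have "\<dots> = (\<Sum>y\<in>N. \<Sum>z\<in>T. \<Sum>y'\<in>N. u y * u y' * (adj E y z * adj E y' z))"
      by (rule sum.swap)
    also have "\<dots> = (\<Sum>y\<in>N. \<Sum>y'\<in>N. \<Sum>z\<in>T. u y * u y' * (adj E y z * adj E y' z))"
      by (intro sum.cong refl sum.swap)
    finally show ?thesis by (simp add: sum_distrib_left)
  qed
  have A: "A u y = (\<Sum>z\<in>N. adj E z y * u z)" for y
    by (simp add: A_def adj_commute)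
  have "(\<Sum>z\<in>S2. (P u z)\<^sup>2) = (\<Sum>y\<in>N. \<Sum>y'\<in>N. u y * u y' * (of_bool (y = y') * (real d - \<beta>)
      + (real \<alpha> - \<beta>) * adj E y y' + (real \<beta> - 1) - (\<Sum>w\<in>N. adj E y w * adj E y' w)))"
    unfolding P_def swap by (intro sum.cong refl) (simp add: codegree_S2)
  also have "\<dots> = (\<Sum>y\<in>N. \<Sum>y'\<in>N. of_bool (y = y') * ((real d - \<beta>) * (u y * u y')))
      + (real \<alpha> - \<beta>) * (\<Sum>y\<in>N. \<Sum>y'\<in>N. u y * (adj E y y' * u y'))
      + (real \<beta> - 1) * (\<Sum>y\<in>N. \<Sum>y'\<in>N. u y * u y')
      - (\<Sum>y\<in>N. \<Sum>y'\<in>N. u y * u y' * (\<Sum>w\<in>N. adj E y w * adj E y' w))"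
    unfolding sum_distrib_left sum.distrib[symmetric] sum_subtractf[symmetric]
    by (intro sum.cong refl) (simp add: sum_distrib_left algebra_simps)
  also have "(\<Sum>y\<in>N. \<Sum>y'\<in>N. of_bool (y = y') * ((real d - \<beta>) * (u y * u y'))) =
      (real d - \<beta>) * (\<Sum>y\<in>N. (u y)\<^sup>2)"
  proof -
    have "(\<Sum>y'\<in>N. of_bool (y = y') * ((real d - \<beta>) * (u y * u y'))) = (real d - \<beta>) * (u y)\<^sup>2"
      if "y \<in> N" for y
    proof -
      have "N \<inter> {y'. y = y'} = {y}" using that by auto
      then show ?thesis using finite_N by (simp add: power2_eq_square)
    qed
    then show ?thesis by (simp add: sum_distrib_left)
  qed
  also have "(\<Sum>y\<in>N. \<Sum>y'\<in>N. u y * (adj E y y' * u y')) = (\<Sum>y\<in>N. u y * A u y)"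
    by (simp add: A_def sum_distrib_left)
  also have "(\<Sum>y\<in>N. \<Sum>y'\<in>N. u y * u y') = (\<Sum>y\<in>N. u y)\<^sup>2"
    by (simp add: power2_eq_square sum_product)
  also have "(\<Sum>y\<in>N. \<Sum>y'\<in>N. u y * u y' * (\<Sum>w\<in>N. adj E y w * adj E y' w)) = (\<Sum>y\<in>N. (A u y)\<^sup>2)"
    unfolding A swap ..
  finally show ?thesis .
qed

text \<open>
  The minimum of \<open>4 \<Gamma>\<^sub>2(f)(x)\<close> over \<open>f x\<close> and the values of \<open>f\<close> on \<open>S2\<close>, when
  \<open>u = f + f x\<close> is prescribed on \<open>N\<close>.
\<close>
definition F :: "('a \<Rightarrow> real) \<Rightarrow> real" where
  "F u = (2 * real d + \<alpha> + 4 - 4 * real d / \<beta>) * (\<Sum>y\<in>N. (u y)\<^sup>2)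
    + (8 - 4 * real \<alpha> / \<beta>) * (\<Sum>y\<in>N. u y * A u y) + 4 / real \<beta> * (\<Sum>y\<in>N. (A u y)\<^sup>2)
    + (4 / real \<beta> - 9 * real \<alpha> / d - 2) * (\<Sum>y\<in>N. u y)\<^sup>2"

lemma Gamma_eq:
  "Gamma_op E all_minus f f x = (\<Sum>y\<in>N. (f y + f x)\<^sup>2) / 2"
  by (simp add: Gamma_op_all_minus power2_eq_square add.commute)

text \<open>Each z in \<open>S2\<close> has \<beta> neighbours in \<open>N\<close>, which gives
  \<beta> as leading coefficient of its square. The remaining -4 / \<beta> times the squared norm of
  \<open>P u\<close> is evaluated by \<open>sum_P_squared\<close>.\<close>

lemma Gamma2_eq:
  fixes f :: "'a \<Rightarrow> real"
  defines "u \<equiv> \<lambda>y. f y + f x"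
  shows "4 * Gamma2_op E all_minus f f x = F u
    + real \<beta> * (\<Sum>z\<in>S2. (f z - f x + 2 * P u z / \<beta>)\<^sup>2)
    + 4 * real \<alpha> * d * (f x - 3 * (\<Sum>y\<in>N. u y) / (2 * d))\<^sup>2"
proof -
  define s where "s = (\<Sum>y\<in>N. u y)"
  define n2 where "n2 = (\<Sum>y\<in>N. (u y)\<^sup>2)"
  define q where "q = (\<Sum>y\<in>N. u y * A u y)"
  define a where "a = f x"
  \<comment> \<open>On \<open>S2\<close> the shift has the opposite sign to that in
    \<open>u\<close>: then f y + f z = u y + w z, and \<open>a\<close> survives only in the edges
    inside \<open>N\<close>.\<close>
  define w where "w z = f z - a" for z
  have fu: "f y = u y - a" and fw: "f y = w y + a" for y
    by (simp_all add: u_def a_def w_def)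
  have "4 * Gamma2_op E all_minus f f x =
      (\<Sum>y\<in>N. (\<Sum>z\<in>nbrs E y. (f y + f z)\<^sup>2 + 2 * u y * (f y + f z)) - n2 + 2 * u y * s)"
    unfolding Gamma2_op_all_minus n2_def s_def u_def
    by (intro sum.cong refl) (simp add: sum.distrib sum_distrib_left algebra_simps)
  also have "\<dots> = (\<Sum>y\<in>N. 3 * (u y)\<^sup>2
      + (\<Sum>z\<in>N. adj E y z * (3 * (u y)\<^sup>2 + 4 * u y * u z + (u z)\<^sup>2 - 8 * a * u y - 4 * a * u z + 4 * a\<^sup>2))
      + (\<Sum>z\<in>S2. adj E y z * (3 * (u y)\<^sup>2 + 4 * u y * w z + (w z)\<^sup>2))
      - n2 + 2 * u y * s)"
  proof (intro sum.cong refl)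
    fix y assume y: "y \<in> N"
    have ux: "(f y + f x)\<^sup>2 + 2 * u y * (f y + f x) = 3 * (u y)\<^sup>2"
      by (simp add: u_def power2_eq_square)
    have uu: "(f y + f z)\<^sup>2 + 2 * u y * (f y + f z) =
        3 * (u y)\<^sup>2 + 4 * u y * u z + (u z)\<^sup>2 - 8 * a * u y - 4 * a * u z + 4 * a\<^sup>2" for z
      by (simp add: fu power2_eq_square algebra_simps)
    have uw: "(f y + f z)\<^sup>2 + 2 * u y * (f y + f z) =
        3 * (u y)\<^sup>2 + 4 * u y * w z + (w z)\<^sup>2" for z
      by (simp add: fu[of y] fw[of z] power2_eq_square algebra_simps)
    show "(\<Sum>z\<in>nbrs E y. (f y + f z)\<^sup>2 + 2 * u y * (f y + f z)) - n2 + 2 * u y * s =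
        3 * (u y)\<^sup>2
        + (\<Sum>z\<in>N. adj E y z * (3 * (u y)\<^sup>2 + 4 * u y * u z + (u z)\<^sup>2 - 8 * a * u y - 4 * a * u z + 4 * a\<^sup>2))
        + (\<Sum>z\<in>S2. adj E y z * (3 * (u y)\<^sup>2 + 4 * u y * w z + (w z)\<^sup>2)) - n2 + 2 * u y * s"
      unfolding sum_nbrs[OF y] ux
      by (intro arg_cong2[where f = "(+)"] arg_cong2[where f = "(-)"] sum.cong refl,
          simp only: uu, simp only: uw)
  qed
  also have "\<dots> = 3 * n2
      + (\<Sum>y\<in>N. \<Sum>z\<in>N. adj E y z * (3 * (u y)\<^sup>2 + 4 * u y * u z + (u z)\<^sup>2 - 8 * a * u y - 4 * a * u z + 4 * a\<^sup>2))
      + (\<Sum>y\<in>N. \<Sum>z\<in>S2. adj E y z * (3 * (u y)\<^sup>2 + 4 * u y * w z + (w z)\<^sup>2))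
      - d * n2 + 2 * s\<^sup>2"
  proof -
    have "(\<Sum>y\<in>N. 3 * (u y)\<^sup>2) = 3 * n2" "(\<Sum>y\<in>N. 2 * u y * s) = 2 * s\<^sup>2"
      unfolding sum_distrib_right[symmetric] sum_distrib_left[symmetric]
      by (simp_all add: n2_def s_def power2_eq_square)
    then show ?thesis by (simp only: sum.distrib sum_subtractf card_N sum_constant)
  qed
  also have "(\<Sum>y\<in>N. \<Sum>z\<in>N. adj E y z * (3 * (u y)\<^sup>2 + 4 * u y * u z + (u z)\<^sup>2 - 8 * a * u y - 4 * a * u z + 4 * a\<^sup>2))
      = 4 * real \<alpha> * n2 + 4 * q - 12 * a * \<alpha> * s + 4 * a\<^sup>2 * d * \<alpha>"
  proof -
    have "(\<Sum>z\<in>N. adj E y z * (3 * (u y)\<^sup>2 + 4 * u y * u z + (u z)\<^sup>2 - 8 * a * u y - 4 * a * u z + 4 * a\<^sup>2))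
        = 3 * real \<alpha> * (u y)\<^sup>2 + 4 * (u y * A u y) + A (\<lambda>z. (u z)\<^sup>2) y - 8 * a * \<alpha> * u y - 4 * a * A u y
          + 4 * a\<^sup>2 * \<alpha>"
      if "y \<in> N" for y
      unfolding A_def sum_adj_N[OF that, symmetric] sum_distrib_left sum_distrib_right
        sum.distrib[symmetric] sum_subtractf[symmetric]
      by (intro sum.cong refl) (simp add: algebra_simps)
    then have "(\<Sum>y\<in>N. \<Sum>z\<in>N. adj E y z * (3 * (u y)\<^sup>2 + 4 * u y * u z + (u z)\<^sup>2 - 8 * a * u y - 4 * a * u z + 4 * a\<^sup>2))
        = 3 * real \<alpha> * n2 + 4 * q + (\<Sum>y\<in>N. A (\<lambda>z. (u z)\<^sup>2) y) - 8 * a * \<alpha> * s - 4 * a * (\<Sum>y\<in>N. A u y)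
          + 4 * a\<^sup>2 * \<alpha> * d"
      by (simp add: n2_def q_def s_def sum.distrib sum_subtractf card_N flip: sum_distrib_left)
    then show ?thesis
      by (simp add: sum_A n2_def s_def)
  qed
  also have "(\<Sum>y\<in>N. \<Sum>z\<in>S2. adj E y z * (3 * (u y)\<^sup>2 + 4 * u y * w z + (w z)\<^sup>2))
      = 3 * (real d - 1 - \<alpha>) * n2 + real \<beta> * (\<Sum>z\<in>S2. (w z + 2 * P u z / \<beta>)\<^sup>2)
        - 4 / \<beta> * (\<Sum>z\<in>S2. (P u z)\<^sup>2)"
  proof -
    have "(\<Sum>y\<in>N. \<Sum>z\<in>S2. adj E y z * (3 * (u y)\<^sup>2 + 4 * u y * w z + (w z)\<^sup>2)) =
        (\<Sum>y\<in>N. \<Sum>z\<in>S2. 3 * (u y)\<^sup>2 * adj E y z) +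
        (\<Sum>y\<in>N. \<Sum>z\<in>S2. 4 * w z * (adj E y z * u y) + (w z)\<^sup>2 * adj E y z)"
      unfolding sum.distrib[symmetric] by (intro sum.cong refl) (simp add: algebra_simps)
    also have "(\<Sum>y\<in>N. \<Sum>z\<in>S2. 3 * (u y)\<^sup>2 * adj E y z) = 3 * (real d - 1 - \<alpha>) * n2"
    proof -
      have "(\<Sum>y\<in>N. \<Sum>z\<in>S2. 3 * (u y)\<^sup>2 * adj E y z) = (\<Sum>y\<in>N. 3 * (real d - 1 - \<alpha>) * (u y)\<^sup>2)"
        by (intro sum.cong refl) (simp add: sum_adj_S2 flip: sum_distrib_left)
      then show ?thesis by (simp add: n2_def sum_distrib_left)
    qed
    also have "(\<Sum>y\<in>N. \<Sum>z\<in>S2. 4 * w z * (adj E y z * u y) + (w z)\<^sup>2 * adj E y z) =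
        (\<Sum>z\<in>S2. \<Sum>y\<in>N. 4 * w z * (adj E y z * u y) + (w z)\<^sup>2 * adj E y z)"
      by (rule sum.swap)
    also have "\<dots> = (\<Sum>z\<in>S2. 4 * w z * P u z + (w z)\<^sup>2 * \<beta>)"
      by (intro sum.cong refl) (simp add: sum.distrib P_def sum_adj_from_S2 flip: sum_distrib_left)
    also have "\<dots> = (\<Sum>z\<in>S2. \<beta> * (w z + 2 * P u z / \<beta>)\<^sup>2 - 4 / \<beta> * (P u z)\<^sup>2)"
      using \<beta>_pos by (intro sum.cong refl) (simp add: field_simps power2_eq_square)
    finally show ?thesis by (simp add: sum_subtractf sum_distrib_left)
  qed
  \<comment> \<open>The terms in \<open>a\<close> complete to the last square and leave -9 \<alpha>
    s^2 / d, the source of that coefficient in \<open>F\<close>.\<close>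
  also have "3 * n2 + (4 * real \<alpha> * n2 + 4 * q - 12 * a * \<alpha> * s + 4 * a\<^sup>2 * d * \<alpha>)
      + (3 * (real d - 1 - \<alpha>) * n2 + real \<beta> * (\<Sum>z\<in>S2. (w z + 2 * P u z / \<beta>)\<^sup>2)
        - 4 / \<beta> * (\<Sum>z\<in>S2. (P u z)\<^sup>2)) - d * n2 + 2 * s\<^sup>2 =
      F u + real \<beta> * (\<Sum>z\<in>S2. (w z + 2 * P u z / \<beta>)\<^sup>2)
    + 4 * real \<alpha> * d * (a - 3 * s / (2 * d))\<^sup>2"
    using \<beta>_pos degree_ge
    unfolding F_def sum_P_squared n2_def[symmetric] q_def[symmetric] s_def[symmetric]
    by (simp add: field_simps power2_eq_square)
  finally show ?thesis by (simp add: w_def a_def s_def)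
qed

lemma Gamma2_ge_iff:
  "(\<forall>f. K * Gamma_op E all_minus f f x \<le> Gamma2_op E all_minus f f x) \<longleftrightarrow>
    (\<forall>u. 2 * K * (\<Sum>y\<in>N. (u y)\<^sup>2) \<le> F u)"
proof (intro iffI allI)
  fix u
  assume K: "\<forall>f. K * Gamma_op E all_minus f f x \<le> Gamma2_op E all_minus f f x"
  \<comment> \<open>\<open>a\<close> and the values on \<open>S2\<close> are the zeros of the two
    kinds of squares in \<open>Gamma2_eq\<close>, while f + f x = u on \<open>N\<close>.\<close>
  define a where "a = 3 * (\<Sum>y\<in>N. u y) / (2 * d)"
  define f where "f z = (if z = x then a else if z \<in> N then u z - a else a - 2 * P u z / \<beta>)" for z
  have x_notin: "x \<notin> N" by (simp add: mem_nbrs no_loop)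
  then have u: "f y + f x = u y" if "y \<in> N" for y
    using that by (auto simp: f_def)
  have "f z - f x + 2 * P (\<lambda>y. f y + f x) z / \<beta> = 0" if "z \<in> S2" for z
    using that by (simp add: P_def u) (auto simp: S2_def f_def P_def)
  then have S2_zero: "(\<Sum>z\<in>S2. (f z - f x + 2 * P (\<lambda>y. f y + f x) z / \<beta>)\<^sup>2) = 0"
    by simp
  have a_zero: "f x - 3 * (\<Sum>y\<in>N. f y + f x) / (2 * d) = 0"
  proof -
    have "(\<Sum>y\<in>N. f y + f x) = (\<Sum>y\<in>N. u y)" by (intro sum.cong refl u)
    then show ?thesis by (simp only: a_def) (simp add: f_def a_def)
  qed
  have "F (\<lambda>y. f y + f x) = F u"
    by (simp add: F_def A_def u)
  then have "4 * Gamma2_op E all_minus f f x = F u"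
    unfolding Gamma2_eq S2_zero a_zero by simp
  then have "Gamma2_op E all_minus f f x = F u / 4" by simp
  moreover have "Gamma_op E all_minus f f x = (\<Sum>y\<in>N. (u y)\<^sup>2) / 2"
    by (simp add: Gamma_eq u)
  ultimately show "2 * K * (\<Sum>y\<in>N. (u y)\<^sup>2) \<le> F u"
    using K[rule_format, of f] by (simp only:)
next
  fix f
  assume K: "\<forall>u. 2 * K * (\<Sum>y\<in>N. (u y)\<^sup>2) \<le> F u"
  have "F (\<lambda>y. f y + f x) \<le> 4 * Gamma2_op E all_minus f f x"
    by (simp add: Gamma2_eq sum_nonneg)
  then show "K * Gamma_op E all_minus f f x \<le> Gamma2_op E all_minus f f x"
    using K[rule_format, of "\<lambda>y. f y + f x"] by (simp add: Gamma_eq)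
qed

section \<open>Spectral splitting of the reduced form\<close>

definition \<kappa> :: real where
  "\<kappa> = (2 * real d * (real \<beta> - 2) - (real \<alpha>)\<^sup>2) / (2 * real \<beta>) + 5 / 2 * real \<alpha> - 2 * real \<beta>"

definition B :: "('a \<Rightarrow> real) \<Rightarrow> 'a \<Rightarrow> real" where
  "B u y = A u y + (real \<beta> - real \<alpha> / 2) * u y"

text \<open>Completing the square in A: since 8 - 4 \<alpha> / \<beta> = (8 / \<beta>) (\<beta> -
  \<alpha> / 2), the shift in \<open>B\<close> absorbs the linear term, and \<kappa> collects the
  rest.\<close>

lemma F_eq:
  "F u = 4 / real \<beta> * (\<Sum>y\<in>N. (B u y)\<^sup>2) + 2 * (\<kappa> + 2) * (\<Sum>y\<in>N. (u y)\<^sup>2)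
    + (4 / real \<beta> - 9 * real \<alpha> / d - 2) * (\<Sum>y\<in>N. u y)\<^sup>2"
proof -
  have "(\<Sum>y\<in>N. (A u y)\<^sup>2) = (\<Sum>y\<in>N. (B u y)\<^sup>2)
      - 2 * (real \<beta> - real \<alpha> / 2) * (\<Sum>y\<in>N. u y * A u y)
      - (real \<beta> - real \<alpha> / 2)\<^sup>2 * (\<Sum>y\<in>N. (u y)\<^sup>2)"
    unfolding sum_distrib_left sum_subtractf[symmetric]
    by (intro sum.cong refl) (simp add: B_def power2_eq_square algebra_simps)
  then show ?thesis
    unfolding F_def \<kappa>_def using \<beta>_pos
    by (simp only:) (simp add: field_simps power2_eq_square[of "real \<alpha>"]
        power2_eq_square[of "real \<beta>"] power2_diff)
qed

lemma F_const: "F (\<lambda>_. c) = 4 * c\<^sup>2 * d"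
  using \<beta>_pos degree_ge
  by (simp add: F_def A_const card_N field_simps power2_eq_square)

lemma F_eigenvector:
  assumes "\<And>y. y \<in> N \<Longrightarrow> A v y = l * v y" and "(\<Sum>y\<in>N. v y) = 0"
  shows "F v = 2 * (2 + \<kappa> + 2 / \<beta> * (l + real \<beta> - real \<alpha> / 2)\<^sup>2) * (\<Sum>y\<in>N. (v y)\<^sup>2)"
proof -
  have "(\<Sum>y\<in>N. (B v y)\<^sup>2) = (l + real \<beta> - real \<alpha> / 2)\<^sup>2 * (\<Sum>y\<in>N. (v y)\<^sup>2)"
    unfolding sum_distrib_left
    by (intro sum.cong refl) (simp add: B_def assms(1) power2_eq_square algebra_simps)
  then show ?thesis by (simp add: F_eq assms(2) algebra_simps)
qed

text \<open>Since \<open>N\<close> induces an \<alpha>-regular graph, \<open>A\<close> preserves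
  both the constants and the functions of sum zero, so all cross terms vanish.\<close>

lemma F_split:
  fixes u :: "'a \<Rightarrow> real"
  defines "c \<equiv> (\<Sum>y\<in>N. u y) / d"
  shows "F u = F (\<lambda>y. u y - c) + F (\<lambda>_. c)"
    and "(\<Sum>y\<in>N. (u y)\<^sup>2) = (\<Sum>y\<in>N. (u y - c)\<^sup>2) + c\<^sup>2 * d"
    and "(\<Sum>y\<in>N. u y - c) = 0"
proof -
  define v where "v y = u y - c" for y
  have v0: "(\<Sum>y\<in>N. v y) = 0"
    using degree_ge by (simp add: v_def sum_subtractf card_N c_def)
  then show "(\<Sum>y\<in>N. u y - c) = 0" by (simp add: v_def)
  have split: "(\<Sum>y\<in>N. (w y + t)\<^sup>2) = (\<Sum>y\<in>N. (w y)\<^sup>2) + t\<^sup>2 * d"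
    if "(\<Sum>y\<in>N. w y) = 0" for w :: "'a \<Rightarrow> real" and t
  proof -
    have "(\<Sum>y\<in>N. (w y + t)\<^sup>2) = (\<Sum>y\<in>N. (w y)\<^sup>2 + 2 * t * w y + t\<^sup>2)"
      by (intro sum.cong refl) (simp add: power2_eq_square algebra_simps)
    then show ?thesis using that by (simp add: sum.distrib card_N flip: sum_distrib_left)
  qed
  have u: "u y = v y + c" for y by (simp add: v_def)
  show n2: "(\<Sum>y\<in>N. (u y)\<^sup>2) = (\<Sum>y\<in>N. (u y - c)\<^sup>2) + c\<^sup>2 * d"
    using split[OF v0, of c] by (simp add: v_def)
  define t where "t = (\<alpha> + (real \<beta> - real \<alpha> / 2)) * c"
  have Bc: "B (\<lambda>_. c) y = t" if "y \<in> N" for y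
    using A_const[OF that] by (simp add: B_def t_def algebra_simps)
  have "B u y = B v y + t" if "y \<in> N" for y
    using A_add_scaled[of v 1 "\<lambda>_. c" y] A_const[OF that, of c]
    by (simp add: B_def t_def v_def field_simps)
  then have "(\<Sum>y\<in>N. (B u y)\<^sup>2) = (\<Sum>y\<in>N. (B v y + t)\<^sup>2)" by simp
  also have "\<dots> = (\<Sum>y\<in>N. (B v y)\<^sup>2) + t\<^sup>2 * d"
    \<comment> \<open>\<open>B v\<close> has sum zero again by \<open>sum_A\<close>, so the same
      Pythagoras identity applies to it.\<close>
    by (rule split) (simp add: B_def sum.distrib sum_A v0 flip: sum_distrib_left)
  finally have B: "(\<Sum>y\<in>N. (B u y)\<^sup>2) = (\<Sum>y\<in>N. (B v y)\<^sup>2) + (\<Sum>y\<in>N. (B (\<lambda>_. c) y)\<^sup>2)"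
    by (simp add: Bc card_N)
  have s: "(\<Sum>y\<in>N. u y) = (\<Sum>y\<in>N. c)"
    using degree_ge by (simp add: c_def card_N)
  have "F u = F v + F (\<lambda>_. c)"
    unfolding F_eq B s v0 n2 by (simp add: v_def card_N algebra_simps)
  then show "F u = F (\<lambda>y. u y - c) + F (\<lambda>_. c)"
    by (simp add: v_def[abs_def])
qed

lemma F_lower_bound:
  assumes m: "\<And>v. m * (\<Sum>y\<in>N. (v y)\<^sup>2) \<le> (\<Sum>y\<in>N. (B v y)\<^sup>2)"
  shows "2 * (2 + min 0 (\<kappa> + 2 / \<beta> * m)) * (\<Sum>y\<in>N. (u y)\<^sup>2) \<le> F u"
proof -
  define c where "c = (\<Sum>y\<in>N. u y) / d"
  define v where "v y = u y - c" for y
  define K where "K = 2 + min 0 (\<kappa> + 2 / \<beta> * m)"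
  define n2 where "n2 = (\<Sum>y\<in>N. (v y)\<^sup>2)"
  have K: "K \<le> 2 + \<kappa> + 2 / \<beta> * m" "K \<le> 2" by (auto simp: K_def)
  have "2 * K * n2 \<le> 2 * (2 + \<kappa> + 2 / \<beta> * m) * n2"
    using K by (intro mult_right_mono) (auto simp: n2_def sum_nonneg)
  also have "\<dots> = 4 / real \<beta> * (m * n2) + 2 * (\<kappa> + 2) * n2"
    by (simp add: algebra_simps)
  also have "\<dots> \<le> 4 / real \<beta> * (\<Sum>y\<in>N. (B v y)\<^sup>2) + 2 * (\<kappa> + 2) * n2"
    unfolding n2_def by (intro add_right_mono mult_left_mono m) auto
  also have "\<dots> = F v"
    using F_split(3)[of u] by (simp add: F_eq n2_def v_def c_def)
  finally have 1: "2 * K * n2 \<le> F v" .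
  have "K * (c\<^sup>2 * d) \<le> 2 * (c\<^sup>2 * d)"
    using K by (intro mult_right_mono) auto
  then have "2 * K * (c\<^sup>2 * d) \<le> F (\<lambda>_. c)" by (simp add: F_const mult_ac)
  with 1 have "2 * K * (n2 + c\<^sup>2 * d) \<le> F v + F (\<lambda>_. c)"
    by (simp add: algebra_simps)
  then show ?thesis
    using F_split(1,2)[of u] by (simp add: K_def n2_def v_def[abs_def] c_def)
qed

text \<open>
  For \<open>\<beta> = 1\<close> the neighbours of \<open>x\<close> induce a disjoint union of at least two cliques of size
  \<open>\<alpha> + 1\<close>, so a centred clique indicator is an eigenvector for \<open>\<alpha>\<close>.
\<close>
lemma clique_indicator_eigenvector:
  assumes "\<beta> = 1"
  obtains v where "\<exists>y\<in>N. v y \<noteq> 0" "\<And>y. y \<in> N \<Longrightarrow> A v y = real \<alpha> * v y" "(\<Sum>y\<in>N. v y) = 0"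
proof -
  \<comment> \<open>For \<beta> = 1, distinct nonadjacent vertices cannot share two
    neighbours.\<close>
  have two: "(y, z) \<in> E"
    if "y \<noteq> z" "w \<in> nbrs E y" "w \<in> nbrs E z" "w' \<in> nbrs E y" "w' \<in> nbrs E z" "w \<noteq> w'" for y z w w'
  proof (rule ccontr)
    assume "(y, z) \<notin> E"
    with that have "card (nbrs E y \<inter> nbrs E z) = 1"
      using common_nonadjacent assms by blast
    then obtain t where "nbrs E y \<inter> nbrs E z = {t}" by (auto simp: card_1_singleton_iff)
    then have "w \<in> {t}" "w' \<in> {t}" using that by (metis IntI)+
    with that show False by simp
  qed
  have "N \<noteq> {}" using card_N degree_ge by auto
  then obtain y where y: "y \<in> N" by auto
  define C where "C = insert y (N \<inter> nbrs E y)"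
  have C_sub: "C \<subseteq> N" using y by (auto simp: C_def)
  have fin_C: "finite C" using C_sub finite_N finite_subset by blast
  have card_C: "card C = \<alpha> + 1"
    using common_adjacent[of x y] y finite_N by (auto simp: C_def mem_nbrs no_loop)
  have clique: "(z, w) \<in> E" if "z \<in> C" "w \<in> C" "z \<noteq> w" for z w
  proof (cases "z = y \<or> w = y")
    case True
    then show ?thesis using that by (auto simp: C_def mem_nbrs edge_commute)
  next
    case False
    then show ?thesis
      using that y by (intro two[of z w x y]) (auto simp: C_def mem_nbrs edge_commute no_loop)
  qed
  \<comment> \<open>A vertex z of \<open>N\<close> adjacent to w in \<open>C\<close> shares x and w
    with y, hence is adjacent to y. So \<open>C\<close> is a whole component of the graph on
    \<open>N\<close>.\<close>
  have closed: "z \<in> C" if "z \<in> N" "w \<in> C" "(z, w) \<in> E" for z w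
  proof (cases "w = y \<or> z = y")
    case True
    then show ?thesis using that by (auto simp: C_def mem_nbrs edge_commute)
  next
    case False
    then have "(y, z) \<in> E"
      using that y by (intro two[of y z x w]) (auto simp: C_def mem_nbrs edge_commute no_loop)
    then show ?thesis using that by (simp add: C_def mem_nbrs)
  qed
  define i where "i z = (of_bool (z \<in> C) :: real)" for z
  have Ai: "A i z = \<alpha> * i z" if z: "z \<in> N" for z
  proof -
    have "A i z = real (card (N \<inter> {w. w \<in> C \<and> (z, w) \<in> E}))"
      using finite_N by (simp add: A_def i_def adj_def flip: of_bool_conj) (simp add: conj_commute)
    also have "N \<inter> {w. w \<in> C \<and> (z, w) \<in> E} = (if z \<in> C then C - {z} else {})"
      using C_sub clique closed[OF z] no_loop by auto
    finally have "A i z = real (card (if z \<in> C then C - {z} else {}))" .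
    also have "\<dots> = \<alpha> * i z" using card_C fin_C by (simp add: i_def)
    finally show ?thesis .
  qed
  \<comment> \<open>The mean of \<open>i\<close> over \<open>N\<close>. It is below 1 because d
    exceeds the clique size \<alpha> + 1, so the centred indicator is nonzero on
    \<open>C\<close>.\<close>
  define c where "c = (real \<alpha> + 1) / d"
  have sum_i: "(\<Sum>z\<in>N. i z) = \<alpha> + 1"
    using finite_N C_sub card_C by (simp add: i_def Int_absorb1)
  show ?thesis
  proof (rule that[of "\<lambda>z. i z - c"])
    have "c < 1" using degree_ge by (simp add: c_def)
    then show "\<exists>z\<in>N. i z - c \<noteq> 0"
      using y by (intro bexI[of _ y]) (auto simp: i_def C_def)
    show "A (\<lambda>z. i z - c) z = \<alpha> * (i z - c)" if "z \<in> N" for z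
      using A_add_scaled[of i "-1" "\<lambda>_. c" z] A_const[OF that, of c] Ai[OF that]
      by (simp add: algebra_simps)
    show "(\<Sum>z\<in>N. i z - c) = 0"
      using degree_ge by (simp add: sum_subtractf sum_i card_N c_def)
  qed
qed

text \<open>
  Constants are eigenvectors for \<open>\<alpha>\<close>, so only \<open>l = \<alpha>\<close> can lack an eigenvector orthogonal to
  them. At \<open>l = \<alpha>\<close> the expression in \<open>neg\<close> is \<open>d + 9 \<alpha> / 2 - 2 d / \<beta>\<close>, which forces \<open>\<beta> = 1\<close>.
\<close>
lemma eigenvector_attaining:
  assumes v: "\<exists>y\<in>N. v y \<noteq> 0" "\<And>y. y \<in> N \<Longrightarrow> A v y = l * v y"
    and neg: "\<kappa> + 2 / \<beta> * (l + real \<beta> - real \<alpha> / 2)\<^sup>2 < 0"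
  obtains w where "\<exists>y\<in>N. w y \<noteq> 0" "\<And>y. y \<in> N \<Longrightarrow> A w y = l * w y" "(\<Sum>y\<in>N. w y) = 0"
proof (cases "l = \<alpha>")
  case False
  \<comment> \<open>Summing the eigenvalue equation over \<open>N\<close> gives (l - \<alpha>) times
    the sum of \<open>v\<close> equal to 0.\<close>
  have "l * (\<Sum>y\<in>N. v y) = real \<alpha> * (\<Sum>y\<in>N. v y)"
    using sum_A[of v] v(2) by (simp add: sum_distrib_left)
  with False have "(\<Sum>y\<in>N. v y) = 0" by simp
  then show ?thesis using that v by blast
next
  case True
  have "\<beta> = 1"
  proof (rule ccontr)
    assume "\<beta> \<noteq> 1"
    with \<beta>_pos have "2 \<le> real \<beta>" by simp
    then have "2 * real d / \<beta> \<le> real d" using mult_left_mono[of 2 "real \<beta>" "real d"] by (simp add: field_simps)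
    moreover have "\<kappa> + 2 / \<beta> * (l + real \<beta> - real \<alpha> / 2)\<^sup>2 = d + 9 / 2 * \<alpha> - 2 * d / \<beta>"
      using \<beta>_pos by (simp add: True \<kappa>_def field_simps power2_eq_square)
    ultimately show False using neg by simp
  qed
  then show ?thesis
    using clique_indicator_eigenvector that True by metis
qed

section \<open>The curvature as an extremal eigenvalue expression\<close>

lemma K_BE_eq:
  assumes spec: "\<And>l. l \<in> \<Lambda> \<longleftrightarrow> (\<exists>v. (\<exists>y\<in>N. v y \<noteq> 0) \<and> (\<forall>y\<in>N. A v y = l * v y))"
    and fin: "finite \<Lambda>"
  shows "K_BE E all_minus x =
    ereal (2 + min 0 (\<kappa> + 2 / \<beta> * (MIN l\<in>\<Lambda>. (l + real \<beta> - real \<alpha> / 2)\<^sup>2)))"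
proof -
  define b where "b = real \<beta> - real \<alpha> / 2"
  have N_ne: "N \<noteq> {}" using card_N degree_ge by auto
  have B: "(\<Sum>z\<in>N. (adj E y z + b * of_bool (y = z)) * u z) = B u y" if "y \<in> N" for u y
  proof -
    have "N \<inter> {z. y = z} = {y}" using that by auto
    then have "(\<Sum>z\<in>N. of_bool (y = z) * u z) = u y"
      using finite_N by simp
    then show ?thesis
      by (simp only: distrib_right sum.distrib mult.assoc sum_distrib_left[symmetric] B_def A_def b_def)
  qed
  \<comment> \<open>\<mu> is an eigenvalue of \<open>B\<close> whose square is the least quotient of
    |B u|^2 by |u|^2. Testing with the eigenvectors of \<open>A\<close> then shows that \<mu>^2 is
    the minimum in the formula.\<close>
  obtain \<mu> v where v: "\<exists>y\<in>N. v y \<noteq> 0" "\<And>y. y \<in> N \<Longrightarrow> B v y = \<mu> * v y"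
    and \<mu>: "\<And>u. \<mu>\<^sup>2 * (\<Sum>y\<in>N. (u y)\<^sup>2) \<le> (\<Sum>y\<in>N. (B u y)\<^sup>2)"
  proof (rule symmetric_min_eigenpair[OF finite_N N_ne, of "\<lambda>y z. adj E y z + b * of_bool (y = z)"])
    show "adj E y z + b * of_bool (y = z) = adj E z y + b * of_bool (z = y)" for y z
      by (auto simp: adj_commute)
  qed (simp add: B, blast)
  define l where "l = \<mu> - b"
  have Av: "A v y = l * v y" if "y \<in> N" for y
    using v(2)[OF that] by (simp add: B_def b_def l_def algebra_simps)
  have l: "l \<in> \<Lambda>" using spec v(1) Av by blast
  have l_sq: "(l + real \<beta> - real \<alpha> / 2)\<^sup>2 = \<mu>\<^sup>2" by (simp add: l_def b_def)
  have "(MIN l\<in>\<Lambda>. (l + real \<beta> - real \<alpha> / 2)\<^sup>2) = \<mu>\<^sup>2"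
  proof (rule Min_eqI)
    show "\<mu>\<^sup>2 \<in> (\<lambda>l. (l + real \<beta> - real \<alpha> / 2)\<^sup>2) ` \<Lambda>" 
      by (rule image_eqI[where x = l]) (simp_all only: l_sq l)
    fix t assume "t \<in> (\<lambda>l. (l + real \<beta> - real \<alpha> / 2)\<^sup>2) ` \<Lambda>"
    then obtain k where "k \<in> \<Lambda>" and t: "t = (k + real \<beta> - real \<alpha> / 2)\<^sup>2" by auto
    then obtain w where w: "\<exists>y\<in>N. w y \<noteq> 0" "\<And>y. y \<in> N \<Longrightarrow> A w y = k * w y"
      using spec by blast
    have "(\<Sum>y\<in>N. (B w y)\<^sup>2) = t * (\<Sum>y\<in>N. (w y)\<^sup>2)"
      unfolding sum_distrib_left t
      by (intro sum.cong refl) (simp add: B_def w(2) power2_eq_square algebra_simps)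
    moreover have "(\<Sum>y\<in>N. (w y)\<^sup>2) > 0"
      using w(1) finite_N by (auto intro: sum_pos2)
    ultimately show "\<mu>\<^sup>2 \<le> t" using \<mu>[of w] by simp
  qed (use fin in simp)
  moreover have "K_BE E all_minus x = ereal (2 + min 0 (\<kappa> + 2 / \<beta> * \<mu>\<^sup>2))"
    unfolding K_BE_def Gamma2_ge_iff
  proof (rule Sup_eqI)
    fix k assume "k \<in> {ereal K |K. \<forall>u. 2 * K * (\<Sum>y\<in>N. (u y)\<^sup>2) \<le> F u}"
    then obtain K where k: "k = ereal K" and K: "\<And>u. 2 * K * (\<Sum>y\<in>N. (u y)\<^sup>2) \<le> F u" by auto
    have "K \<le> 2"
      using K[of "\<lambda>_. 1"] degree_ge by (simp add: F_const card_N)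
    \<comment> \<open>If the bracket is nonnegative, the bound 2 from constants is already the
      claim. Only a negative bracket needs an eigenvector of sum zero.\<close>
    moreover have "K \<le> 2 + \<kappa> + 2 / \<beta> * \<mu>\<^sup>2" if neg: "\<kappa> + 2 / \<beta> * \<mu>\<^sup>2 < 0"
    proof -
      obtain w where w: "\<exists>y\<in>N. w y \<noteq> 0" "\<And>y. y \<in> N \<Longrightarrow> A w y = l * w y" "(\<Sum>y\<in>N. w y) = 0"
        using eigenvector_attaining[OF v(1) Av neg[folded l_sq]] by blast
      have "(\<Sum>y\<in>N. (w y)\<^sup>2) > 0"
        using w(1) finite_N by (auto intro: sum_pos2)
      moreover have "F w = 2 * (2 + \<kappa> + 2 / \<beta> * \<mu>\<^sup>2) * (\<Sum>y\<in>N. (w y)\<^sup>2)"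
        using F_eigenvector[of w l, OF w(2,3)] by (simp only: l_sq)
      ultimately show ?thesis
        using K[of w] by simp
    qed
    ultimately show "k \<le> ereal (2 + min 0 (\<kappa> + 2 / \<beta> * \<mu>\<^sup>2))"
      unfolding k by (auto simp: min_def)
  next
    fix s assume "\<And>k. k \<in> {ereal K |K. \<forall>u. 2 * K * (\<Sum>y\<in>N. (u y)\<^sup>2) \<le> F u} \<Longrightarrow> k \<le> s"
    then show "ereal (2 + min 0 (\<kappa> + 2 / \<beta> * \<mu>\<^sup>2)) \<le> s"
      using F_lower_bound[OF \<mu>] by blast
  qed
  ultimately show ?thesis by simp
qed

end

subsection \<open>Pairs at distance two\<close>

lemma graph_dist_eq_2:
  assumes "y \<noteq> z" "(y, z) \<notin> E" "(y, w) \<in> E" "(w, z) \<in> E"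
  shows "graph_dist E y z = 2"
  unfolding graph_dist_def
proof (rule antisym)
  have "(y, z) \<in> E ^^ 2" using assms(3,4) by (auto simp: numeral_2_eq_2)
  then show "Inf {enat k |k. (y, z) \<in> E ^^ k} \<le> 2"
    by (intro Inf_lower) (auto simp: numeral_eq_enat)
  show "2 \<le> Inf {enat k |k. (y, z) \<in> E ^^ k}"
  proof (rule Inf_greatest)
    fix t assume "t \<in> {enat k |k. (y, z) \<in> E ^^ k}"
    then obtain k where k: "t = enat k" "(y, z) \<in> E ^^ k" by auto
    have "2 \<le> k"
    proof (rule ccontr)
      assume "\<not> 2 \<le> k"
      then have "k = 0 \<or> k = 1" by auto
      then show False using k(2) assms(1,2) by auto
    qed
    then show "2 \<le> t" by (simp add: k(1) numeral_eq_enat)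
  qed
qed

text \<open>If no vertex were at distance two from p, then p with its neighbours would be closed
  under edges and would contain every vertex reachable from p, including a nonadjacent q.\<close>

lemma exists_distance_2:
  assumes "connected_graph V E" "\<not> complete_graph V E"
  obtains y w z where "y \<noteq> z" "(y, z) \<notin> E" "(y, w) \<in> E" "(w, z) \<in> E"
proof -
  obtain p q where pq: "p \<in> V" "q \<in> V" "p \<noteq> q" "(p, q) \<notin> E"
    using assms(2) by (auto simp: complete_graph_def)
  have "\<exists>w z. p \<noteq> z \<and> (p, z) \<notin> E \<and> (p, w) \<in> E \<and> (w, z) \<in> E"
  proof (rule ccontr)
    assume no: "\<not> ?thesis"
    have "(p, q) \<in> E\<^sup>*" using assms(1) pq by (auto simp: connected_graph_def)
    then have "p = q \<or> (p, q) \<in> E"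
      by (induction rule: rtrancl_induct) (use no in blast)+
    with pq show False by simp
  qed
  then show ?thesis using that by blast
qed

text \<open>Let r be the middle vertex of a pair p, q at distance two. It witnesses \<beta> > 0, and
  its neighbours include p, q and the \<alpha> common neighbours of r and p, none of which is p or
  q; hence \<alpha> + 2 \<le> d.\<close>

lemma amply_regular_at:
  assumes "amply_regular V E n d \<alpha> \<beta>" and conn: "connected_graph V E" "\<not> complete_graph V E"
    and "x \<in> V"
  shows "amply_regular_at V E d \<alpha> \<beta> x"
proof -
  have E: "E \<subseteq> V \<times> V" "sym E" "irrefl E"
    and deg: "\<And>y. y \<in> V \<Longrightarrow> finite (nbrs E y) \<and> card (nbrs E y) = d"
    and adjacent: "\<And>y z. (y, z) \<in> E \<Longrightarrow> card (nbrs E y \<inter> nbrs E z) = \<alpha>"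
    and dist2: "\<And>y z. y \<in> V \<Longrightarrow> z \<in> V \<Longrightarrow> graph_dist E y z = 2 \<Longrightarrow> card (nbrs E y \<inter> nbrs E z) = \<beta>"
    using assms(1) by (auto simp: amply_regular_def simple_graph_def)
  have nonadjacent: "card (nbrs E y \<inter> nbrs E z) = \<beta>"
    if "y \<noteq> z" "(y, z) \<notin> E" "w \<in> nbrs E y" "w \<in> nbrs E z" for y z w
    using that E by (intro dist2 graph_dist_eq_2[of y z E w]) (auto simp: nbrs_def sym_def)
  obtain p r q where pq: "p \<noteq> q" "(p, q) \<notin> E" "(p, r) \<in> E" "(r, q) \<in> E"
    using exists_distance_2[OF conn] by metis
  have V: "p \<in> V" "r \<in> V" using pq E by auto
  have r: "r \<in> nbrs E p" "r \<in> nbrs E q" using pq E(2) by (auto simp: nbrs_def sym_def)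
  then have "0 < card (nbrs E p \<inter> nbrs E q)" using deg[OF V(1)] by (auto simp: card_gt_0_iff)
  then have "0 < \<beta>" using nonadjacent[OF pq(1,2) r] by simp
  moreover have "\<alpha> + 2 \<le> d"
  proof -
    let ?T = "nbrs E r \<inter> nbrs E p"
    have "card ?T = \<alpha>" using pq E(2) by (intro adjacent) (auto simp: sym_def)
    moreover have "p \<notin> ?T" "q \<notin> ?T" "finite ?T"
      using pq E(3) deg[OF V(1)] by (auto simp: nbrs_def irrefl_def)
    ultimately have "card (insert p (insert q ?T)) = \<alpha> + 2"
      using pq(1) by simp
    moreover have "card (insert p (insert q ?T)) \<le> card (nbrs E r)"
      using pq E(2) deg[OF V(2)] by (intro card_mono) (auto simp: nbrs_def sym_def)
    ultimately show ?thesis using deg[OF V(2)] by simp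
  qed
  ultimately show ?thesis
    using E deg adjacent nonadjacent assms(4) by unfold_locales auto
qed

theorem theorem4p7:
  fixes V :: "'a set" and E :: "'a rel" and n :: enat and d \<alpha> \<beta> :: nat
    and x :: 'a and vs :: "'a list"
  assumes "amply_regular V E n d \<alpha> \<beta>"
    and "connected_graph V E"
    and "\<not> complete_graph V E"
    and "\<not> empty_graph E"
    and "x \<in> V"
    and "distinct vs" and "set vs = nbrs E x"
  shows "K_BE E all_minus x = ereal (2 + min 0
     ((2 * real d * (real \<beta> - 2) - (real \<alpha>)\<^sup>2) / (2 * real \<beta>)
      + 5 / 2 * real \<alpha> - 2 * real \<beta>
      + 2 / real \<beta> *
          (MIN l\<in>spectrum (induced_adj_mat E vs). (l + real \<beta> - real \<alpha> / 2)\<^sup>2)))"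
proof -
  interpret amply_regular_at V E d \<alpha> \<beta> x
    by (rule amply_regular_at) fact+
  have "finite (spectrum (induced_adj_mat E vs))"
    by (rule card_finite_spectrum(1)[of _ "length vs"]) (simp add: induced_adj_mat_def)
  from K_BE_eq[OF _ this] show ?thesis
    using mem_spectrum_induced_adj_mat_iff[OF assms(6)] assms(7) by (simp add: \<kappa>_def A_def)
qed

end
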